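(* The pure twin group $PT_n$ is not free for $n\ge 6$. Further, $PT_n$ is torsion-free for $n\ge 3$.
   Context: For an integer $n\ge 2$, the twin group $T_n$ is the group generated by $s_1,\dots,s_{n-1}$ with defining relations $s_i^2=1$ for $1\le i\le n-1$ and $s_is_j=s_js_i$ for $|i-j|\ge 2$. The pure twin group $PT_n$ is the kernel of the homomorphism $\pi:T_n\to S_n$ to the symmetric group on $\{1,\dots,n\}$ that maps $s_i$ to the transposition $(i,i+1)$ for $1\le i\le n-1$. *)

theory Defs
  imports "HOL-Algebra.Sym_Groups"
begin

section \<open>Groups given by generators and relations\<close>

text \<open>A letter \<open>(x, True)\<close> stands for the generator \<open>x\<close>, and \<open>(x, False)\<close> for its formal inverse.\<close>

type_synonym 'a word = "('a \<times> bool) list"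

definition words :: "'a set \<Rightarrow> 'a word set" where
  "words X = lists (X \<times> UNIV)"

text \<open>A pair \<open>(u, v) \<in> R\<close> is the defining relation \<open>u = v\<close>. The congruence below is the least one on
  words that contains the defining relations and makes \<open>x\<close> and its formal inverse mutually inverse.\<close>

inductive_set pres_cong :: "'a set \<Rightarrow> ('a word \<times> 'a word) set \<Rightarrow> ('a word \<times> 'a word) set"
  for X :: "'a set" and R :: "('a word \<times> 'a word) set" where
  cancel: "x \<in> X \<Longrightarrow> ([(x, b), (x, \<not> b)], []) \<in> pres_cong X R"
| rel: "(u, v) \<in> R \<Longrightarrow> u \<in> words X \<Longrightarrow> v \<in> words X \<Longrightarrow> (u, v) \<in> pres_cong X R"
| refl: "u \<in> words X \<Longrightarrow> (u, u) \<in> pres_cong X R"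
| sym: "(u, v) \<in> pres_cong X R \<Longrightarrow> (v, u) \<in> pres_cong X R"
| trans: "(u, v) \<in> pres_cong X R \<Longrightarrow> (v, w) \<in> pres_cong X R \<Longrightarrow> (u, w) \<in> pres_cong X R"
| append: "(u, u') \<in> pres_cong X R \<Longrightarrow> (v, v') \<in> pres_cong X R
    \<Longrightarrow> (u @ v, u' @ v') \<in> pres_cong X R"

definition presented_group :: "'a set \<Rightarrow> ('a word \<times> 'a word) set \<Rightarrow> 'a word set monoid" where
  "presented_group X R =
    \<lparr> carrier = words X // pres_cong X R,
      mult = (\<lambda>A B. \<Union>u\<in>A. \<Union>v\<in>B. pres_cong X R `` {u @ v}),
      one = pres_cong X R `` {[]} \<rparr>"

definition pres_gen :: "'a set \<Rightarrow> ('a word \<times> 'a word) set \<Rightarrow> 'a \<Rightarrow> 'a word set" where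
  "pres_gen X R x = pres_cong X R `` {[(x, True)]}"

definition letter_eval :: "('g, 'm) monoid_scheme \<Rightarrow> ('a \<Rightarrow> 'g) \<Rightarrow> 'a \<times> bool \<Rightarrow> 'g" where
  "letter_eval G f l = (if snd l then f (fst l) else inv\<^bsub>G\<^esub> (f (fst l)))"

definition word_eval :: "('g, 'm) monoid_scheme \<Rightarrow> ('a \<Rightarrow> 'g) \<Rightarrow> 'a word \<Rightarrow> 'g" where
  "word_eval G f w = foldr (\<lambda>l g. letter_eval G f l \<otimes>\<^bsub>G\<^esub> g) w \<one>\<^bsub>G\<^esub>"

text \<open>The homomorphism out of a presented group induced by \<open>x \<mapsto> f x\<close>. It is meaningful only if
  \<open>f\<close> respects the defining relations; then \<open>word_eval G f\<close> is constant on each class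
  (see \<open>pres_lift_hom\<close>, \<open>pres_lift_gen\<close> and \<open>pres_lift_unique\<close>).\<close>

definition pres_lift :: "('g, 'm) monoid_scheme \<Rightarrow> ('a \<Rightarrow> 'g) \<Rightarrow> 'a word set \<Rightarrow> 'g" where
  "pres_lift G f A = the_elem (word_eval G f ` A)"

lemma words_simps [simp]:
  "[] \<in> words X"
  "l # w \<in> words X \<longleftrightarrow> fst l \<in> X \<and> w \<in> words X"
  "u @ v \<in> words X \<longleftrightarrow> u \<in> words X \<and> v \<in> words X"
  by (auto simp: words_def mem_Times_iff)

lemma pres_cong_words:
  "(u, v) \<in> pres_cong X R \<Longrightarrow> u \<in> words X \<and> v \<in> words X"
  by (induction rule: pres_cong.induct) auto

lemma equiv_pres_cong: "equiv (words X) (pres_cong X R)"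
proof (rule equivI)
  show "pres_cong X R \<subseteq> words X \<times> words X"
    using pres_cong_words by fast
  show "refl_on (words X) (pres_cong X R)"
    by (auto intro!: refl_onI pres_cong.refl)
  show "sym_on UNIV (pres_cong X R)"
    by (auto intro!: symI pres_cong.sym)
  show "trans_on UNIV (pres_cong X R)"
    by (meson transI pres_cong.trans)
qed

lemma pres_class_eq:
  assumes "u \<in> words X" "v \<in> words X"
  shows "pres_cong X R `` {u} = pres_cong X R `` {v} \<longleftrightarrow> (u, v) \<in> pres_cong X R"
  using assms by (rule eq_equiv_class_iff[OF equiv_pres_cong])

lemma presented_group_carrier_iff:
  "A \<in> carrier (presented_group X R) \<longleftrightarrow> (\<exists>u\<in>words X. A = pres_cong X R `` {u})"
  by (auto simp: presented_group_def quotient_def)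

lemma pres_class_carrier:
  "u \<in> words X \<Longrightarrow> pres_cong X R `` {u} \<in> carrier (presented_group X R)"
  by (auto simp: presented_group_carrier_iff)

lemma presented_group_mult:
  assumes "u \<in> words X" "v \<in> words X"
  shows "(pres_cong X R `` {u}) \<otimes>\<^bsub>presented_group X R\<^esub> (pres_cong X R `` {v})
    = pres_cong X R `` {u @ v}"
proof -
  have eq: "pres_cong X R `` {u' @ v'} = pres_cong X R `` {u @ v}"
    if "(u, u') \<in> pres_cong X R" "(v, v') \<in> pres_cong X R" for u' v'
    using equiv_class_eq[OF equiv_pres_cong pres_cong.append[OF that]] by simp
  have "(\<Union>u'\<in>pres_cong X R `` {u}. \<Union>v'\<in>pres_cong X R `` {v}. pres_cong X R `` {u' @ v'})
    = (\<Union>u'\<in>pres_cong X R `` {u}. \<Union>v'\<in>pres_cong X R `` {v}. pres_cong X R `` {u @ v})"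
    using eq by (intro SUP_cong) auto
  also have "\<dots> = pres_cong X R `` {u @ v}"
    using pres_cong.refl[OF assms(1)] pres_cong.refl[OF assms(2)] by blast
  finally show ?thesis
    by (simp add: presented_group_def)
qed

lemma presented_group_one: "\<one>\<^bsub>presented_group X R\<^esub> = pres_cong X R `` {[]}"
  by (simp add: presented_group_def)

definition word_inv :: "'a word \<Rightarrow> 'a word" where
  "word_inv w = rev (map (\<lambda>l. (fst l, \<not> snd l)) w)"

lemma word_inv_words [simp]: "w \<in> words X \<Longrightarrow> word_inv w \<in> words X"
  by (induction w) (auto simp: word_inv_def)

lemma word_inv_left: "w \<in> words X \<Longrightarrow> (word_inv w @ w, []) \<in> pres_cong X R"
proof (induction w)
  case Nil
  then show ?case by (simp add: word_inv_def pres_cong.refl)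
next
  case (Cons l w)
  obtain x b where l: "l = (x, b)" by fastforce
  have x: "x \<in> X" and w: "w \<in> words X" using Cons.prems l by auto
  have c: "([(x, \<not> b), (x, b)], []) \<in> pres_cong X R"
    using pres_cong.cancel[OF x, of "\<not> b"] by simp
  have "([(x, \<not> b), (x, b)] @ w, [] @ w) \<in> pres_cong X R"
    by (rule pres_cong.append[OF c pres_cong.refl[OF w]])
  then have "(word_inv w @ ([(x, \<not> b), (x, b)] @ w), word_inv w @ ([] @ w)) \<in> pres_cong X R"
    by (rule pres_cong.append[OF pres_cong.refl[OF word_inv_words[OF w]]])
  then have "(word_inv (l # w) @ (l # w), word_inv w @ w) \<in> pres_cong X R"
    by (simp add: word_inv_def l)
  then show ?case using Cons.IH[OF w] by (rule pres_cong.trans)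
qed

lemma group_presented_group: "group (presented_group X R)"
proof (rule groupI)
  fix A assume "A \<in> carrier (presented_group X R)"
  then obtain u where u: "u \<in> words X" "A = pres_cong X R `` {u}"
    by (auto simp: presented_group_carrier_iff)
  show "\<one>\<^bsub>presented_group X R\<^esub> \<otimes>\<^bsub>presented_group X R\<^esub> A = A"
    using presented_group_mult[of "[]" X u R] u by (simp add: presented_group_one)
  have "pres_cong X R `` {word_inv u} \<otimes>\<^bsub>presented_group X R\<^esub> A = \<one>\<^bsub>presented_group X R\<^esub>"
    using word_inv_left[OF u(1)] u
    by (simp add: presented_group_one presented_group_mult pres_class_eq)
  moreover have "pres_cong X R `` {word_inv u} \<in> carrier (presented_group X R)"
    using u by (simp add: pres_class_carrier)
  ultimately show "\<exists>B\<in>carrier (presented_group X R).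
      B \<otimes>\<^bsub>presented_group X R\<^esub> A = \<one>\<^bsub>presented_group X R\<^esub>"
    by blast
next
  fix A B assume "A \<in> carrier (presented_group X R)" "B \<in> carrier (presented_group X R)"
  then show "A \<otimes>\<^bsub>presented_group X R\<^esub> B \<in> carrier (presented_group X R)"
    by (auto simp: presented_group_carrier_iff presented_group_mult)
next
  fix A B C
  assume "A \<in> carrier (presented_group X R)" "B \<in> carrier (presented_group X R)"
    "C \<in> carrier (presented_group X R)"
  then show "A \<otimes>\<^bsub>presented_group X R\<^esub> B \<otimes>\<^bsub>presented_group X R\<^esub> C
    = A \<otimes>\<^bsub>presented_group X R\<^esub> (B \<otimes>\<^bsub>presented_group X R\<^esub> C)"
    by (auto simp: presented_group_carrier_iff presented_group_mult)
next
  show "\<one>\<^bsub>presented_group X R\<^esub> \<in> carrier (presented_group X R)"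
    by (simp add: presented_group_one pres_class_carrier)
qed

lemma pres_gen_carrier: "x \<in> X \<Longrightarrow> pres_gen X R x \<in> carrier (presented_group X R)"
  by (auto simp: pres_gen_def intro!: pres_class_carrier)

context group
begin

lemma word_eval_Nil [simp]: "word_eval G f [] = \<one>"
  by (simp add: word_eval_def)

lemma word_eval_Cons [simp]: "word_eval G f (l # w) = letter_eval G f l \<otimes> word_eval G f w"
  by (simp add: word_eval_def)

lemma letter_eval_closed:
  "f \<in> X \<rightarrow> carrier G \<Longrightarrow> fst l \<in> X \<Longrightarrow> letter_eval G f l \<in> carrier G"
  by (auto simp: letter_eval_def Pi_iff)

lemma word_eval_closed:
  "f \<in> X \<rightarrow> carrier G \<Longrightarrow> w \<in> words X \<Longrightarrow> word_eval G f w \<in> carrier G"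
  by (induction w) (auto simp: letter_eval_closed)

lemma word_eval_append:
  assumes f: "f \<in> X \<rightarrow> carrier G" and "u \<in> words X" "v \<in> words X"
  shows "word_eval G f (u @ v) = word_eval G f u \<otimes> word_eval G f v"
  using assms(2)
proof (induction u)
  case Nil
  then show ?case using word_eval_closed[OF f assms(3)] by simp
next
  case (Cons l u)
  then show ?case
    using word_eval_closed[OF f assms(3)] word_eval_closed[OF f, of u] letter_eval_closed[OF f, of l]
    by (simp add: m_assoc)
qed

lemma word_eval_cong:
  assumes f: "f \<in> X \<rightarrow> carrier G"
    and R: "\<And>u v. (u, v) \<in> R \<Longrightarrow> word_eval G f u = word_eval G f v"
    and uv: "(u, v) \<in> pres_cong X R"
  shows "word_eval G f u = word_eval G f v"
  using uv
proof (induction rule: pres_cong.induct)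
  case (cancel x b)
  then have "f x \<in> carrier G" using f by auto
  then show ?case by (cases b) (auto simp: letter_eval_def)
next
  case (append u u' v v')
  then show ?case
    using pres_cong_words[OF append.hyps(1)] pres_cong_words[OF append.hyps(2)]
    by (simp add: word_eval_append[OF f])
qed (auto simp: R)

lemma pres_lift_class:
  assumes "f \<in> X \<rightarrow> carrier G"
    and "\<And>u v. (u, v) \<in> R \<Longrightarrow> word_eval G f u = word_eval G f v"
    and "u \<in> words X"
  shows "pres_lift G f (pres_cong X R `` {u}) = word_eval G f u"
proof -
  have "word_eval G f ` (pres_cong X R `` {u}) = {word_eval G f u}"
  proof -
    have "word_eval G f v = word_eval G f u" if "(u, v) \<in> pres_cong X R" for v
      using word_eval_cong[of f X R u v] assms(1,2) that by metis
    then show ?thesis using pres_cong.refl[OF assms(3), of R] by blast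
  qed
  then show ?thesis by (simp add: pres_lift_def)
qed

lemma pres_lift_hom:
  assumes "f \<in> X \<rightarrow> carrier G"
    and "\<And>u v. (u, v) \<in> R \<Longrightarrow> word_eval G f u = word_eval G f v"
  shows "pres_lift G f \<in> hom (presented_group X R) G"
proof -
  have lift: "pres_lift G f (pres_cong X R `` {u}) = word_eval G f u" if "u \<in> words X" for u
    by (rule pres_lift_class) (use assms that in auto)
  show ?thesis
  proof (rule homI)
    fix A assume "A \<in> carrier (presented_group X R)"
    then show "pres_lift G f A \<in> carrier G"
      using lift word_eval_closed[OF assms(1)]
      by (auto simp: presented_group_carrier_iff)
  next
    fix A B assume "A \<in> carrier (presented_group X R)" "B \<in> carrier (presented_group X R)"
    then obtain u v where "u \<in> words X" "v \<in> words X"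
      "A = pres_cong X R `` {u}" "B = pres_cong X R `` {v}"
      by (auto simp: presented_group_carrier_iff)
    then show "pres_lift G f (A \<otimes>\<^bsub>presented_group X R\<^esub> B) = pres_lift G f A \<otimes> pres_lift G f B"
      using lift word_eval_append[OF assms(1)]
      by (simp add: presented_group_mult)
  qed
qed

lemma pres_lift_gen:
  assumes "f \<in> X \<rightarrow> carrier G"
    and "\<And>u v. (u, v) \<in> R \<Longrightarrow> word_eval G f u = word_eval G f v"
    and "x \<in> X"
  shows "pres_lift G f (pres_gen X R x) = f x"
proof -
  have "pres_lift G f (pres_cong X R `` {[(x, True)]}) = word_eval G f [(x, True)]"
    by (rule pres_lift_class) (use assms in auto)
  moreover have "f x \<in> carrier G" using assms(1,3) by auto
  ultimately show ?thesis by (simp add: pres_gen_def letter_eval_def)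
qed

lemma pres_lift_unique:
  assumes f: "f \<in> X \<rightarrow> carrier G"
    and R: "\<And>u v. (u, v) \<in> R \<Longrightarrow> word_eval G f u = word_eval G f v"
    and h: "h \<in> hom (presented_group X R) G" and hf: "\<And>x. x \<in> X \<Longrightarrow> h (pres_gen X R x) = f x"
    and A: "A \<in> carrier (presented_group X R)"
  shows "h A = pres_lift G f A"
proof -
  interpret P: group "presented_group X R" by (rule group_presented_group)
  interpret h: group_hom "presented_group X R" G h
    using h by unfold_locales
  have letter: "h (pres_cong X R `` {[l]}) = letter_eval G f l" if "fst l \<in> X" for l
  proof (cases l)
    case (Pair x b)
    then have x: "x \<in> X" using that by simp
    show ?thesis
    proof (cases b)
      case True
      then show ?thesis using Pair hf[OF x] by (simp add: letter_eval_def pres_gen_def)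
    next
      case False
      have "pres_cong X R `` {[(x, False)]} \<otimes>\<^bsub>presented_group X R\<^esub> pres_gen X R x
        = \<one>\<^bsub>presented_group X R\<^esub>"
        using x pres_cong.cancel[of x X False R]
        by (simp add: pres_gen_def presented_group_mult presented_group_one pres_class_eq)
      moreover have "pres_cong X R `` {[(x, False)]} \<in> carrier (presented_group X R)"
        using x by (auto intro!: pres_class_carrier)
      ultimately have "pres_cong X R `` {[(x, False)]} = inv\<^bsub>presented_group X R\<^esub> pres_gen X R x"
        using P.inv_equality[of _ "pres_gen X R x"] pres_gen_carrier[OF x, of R] by simp
      then show ?thesis
        using Pair False hf[OF x] pres_gen_carrier[OF x, of R] by (simp add: letter_eval_def)
    qed
  qed
  have word: "h (pres_cong X R `` {w}) = word_eval G f w" if "w \<in> words X" for w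
    using that
  proof (induction w)
    case Nil
    then show ?case using h.hom_one by (simp add: presented_group_one)
  next
    case (Cons l w)
    have "pres_cong X R `` {[l]} \<in> carrier (presented_group X R)"
      "pres_cong X R `` {w} \<in> carrier (presented_group X R)"
      using Cons.prems by (auto intro!: pres_class_carrier)
    moreover have "pres_cong X R `` {l # w}
      = pres_cong X R `` {[l]} \<otimes>\<^bsub>presented_group X R\<^esub> pres_cong X R `` {w}"
      using Cons.prems by (simp add: presented_group_mult)
    ultimately show ?case using Cons letter[of l] by simp
  qed
  obtain u where "u \<in> words X" "A = pres_cong X R `` {u}"
    using A by (auto simp: presented_group_carrier_iff)
  moreover from this have "pres_lift G f A = word_eval G f u"
    using pres_lift_class[of f X R u] f R by metis
  ultimately show ?thesis using word by simp
qed

end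


section \<open>Free groups and torsion-free groups\<close>

definition free_group :: "'a set \<Rightarrow> 'a word set monoid" where
  "free_group X = presented_group X {}"

text \<open>\<open>X\<close> is a free basis of \<open>G\<close>: the homomorphism from the free group on \<open>X\<close> to \<open>G\<close> that extends
  the inclusion of \<open>X\<close> is an isomorphism.\<close>

definition is_free_basis :: "('g, 'm) monoid_scheme \<Rightarrow> 'g set \<Rightarrow> bool" where
  "is_free_basis G X \<longleftrightarrow> X \<subseteq> carrier G \<and> pres_lift G (\<lambda>x. x) \<in> iso (free_group X) G"

definition is_free_group :: "('g, 'm) monoid_scheme \<Rightarrow> bool" where
  "is_free_group G \<longleftrightarrow> (\<exists>X. is_free_basis G X)"

definition torsion_free_group :: "('g, 'm) monoid_scheme \<Rightarrow> bool" where
  "torsion_free_group G \<longleftrightarrow>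
    (\<forall>g\<in>carrier G. g \<noteq> \<one>\<^bsub>G\<^esub> \<longrightarrow> (\<forall>k::nat. k > 0 \<longrightarrow> g [^]\<^bsub>G\<^esub> k \<noteq> \<one>\<^bsub>G\<^esub>))"


section \<open>Twin groups and pure twin groups\<close>

definition twin_relations :: "nat \<Rightarrow> (nat word \<times> nat word) set" where
  "twin_relations n =
    {([(i, True), (i, True)], []) | i. i \<in> {1..n - 1}} \<union>
    {([(i, True), (j, True)], [(j, True), (i, True)]) | i j.
      i \<in> {1..n - 1} \<and> j \<in> {1..n - 1} \<and> \<bar>int i - int j\<bar> \<ge> 2}"

definition twin_group :: "nat \<Rightarrow> nat word set monoid" where
  "twin_group n = presented_group {1..n - 1} (twin_relations n)"

definition twin_gen :: "nat \<Rightarrow> nat \<Rightarrow> nat word set" where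
  "twin_gen n = pres_gen {1..n - 1} (twin_relations n)"

definition twin_perm :: "nat \<Rightarrow> nat word set \<Rightarrow> nat \<Rightarrow> nat" where
  "twin_perm n = pres_lift (sym_group n) (\<lambda>i. transpose i (i + 1))"

definition pure_twin_group :: "nat \<Rightarrow> nat word set monoid" where
  "pure_twin_group n =
    (twin_group n)\<lparr>carrier := kernel (twin_group n) (sym_group n) (twin_perm n)\<rparr>"

lemma transpose_sym_group:
  "(\<lambda>i. transpose i (i + 1)) \<in> {1..n - 1} \<rightarrow> carrier (sym_group n)"
  by (auto simp: sym_group_carrier intro!: permutes_swap_id)

lemma transpose_twin_relations:
  assumes "(u, v) \<in> twin_relations n"
  shows "word_eval (sym_group n) (\<lambda>i. transpose i (i + 1)) u
    = word_eval (sym_group n) (\<lambda>i. transpose i (i + 1)) v"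
  using assms
  by (auto simp: twin_relations_def word_eval_def letter_eval_def sym_group_mult sym_group_one
      fun_eq_iff transpose_def)

lemma twin_perm_hom: "twin_perm n \<in> hom (twin_group n) (sym_group n)"
  unfolding twin_perm_def twin_group_def
  by (rule group.pres_lift_hom[OF sym_group_is_group transpose_sym_group transpose_twin_relations])

lemma twin_perm_gen: "i \<in> {1..n - 1} \<Longrightarrow> twin_perm n (twin_gen n i) = transpose i (i + 1)"
  unfolding twin_perm_def twin_gen_def
  by (rule group.pres_lift_gen[OF sym_group_is_group transpose_sym_group transpose_twin_relations])

lemma group_pure_twin_group: "group (pure_twin_group n)"
proof -
  interpret group_hom "twin_group n" "sym_group n" "twin_perm n"
    using twin_perm_hom group_presented_group sym_group_is_group
    by (auto simp: group_hom_def group_hom_axioms_def twin_group_def)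
  show ?thesis
    unfolding pure_twin_group_def by (rule G.subgroup_imp_group[OF subgroup_kernel])
qed

end

theory Submission
  imports Defs
begin

text \<open>
  Torsion: let \<open>w\<close> be a word for a pure element of finite order. If \<open>w\<close> is not reduced, or if the
  commutation relations turn it into \<open>x v x\<close>, it can be shortened without changing the conjugacy
  class, so induction on the length applies. If some letter \<open>i\<close> of a reduced \<open>w\<close> commutes with all
  the others, the permutation of \<open>w\<close> sends \<open>i\<close> to \<open>i + 1\<close>, contrary to purity. In the remaining
  case every power of \<open>w\<close> is reduced, and a nonempty reduced word represents a nontrivial element.

  Freeness: two commuting nontrivial elements of a free group satisfy \<open>A\<^sup>k = B\<^sup>l\<close> for some \<open>k > 0\<close>. If
  \<open>n \<ge> 6\<close>, the elements \<open>(s\<^sub>1 s\<^sub>2)\<^sup>3\<close> and \<open>(s\<^sub>4 s\<^sub>5)\<^sup>3\<close> of the pure twin group commute, but killing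
  \<open>s\<^sub>i\<close> for \<open>i > 2\<close> shows that no such relation holds, as the first one has infinite order.
\<close>

section \<open>Commuting elements of a free group\<close>

definition linv :: "'a \<times> bool \<Rightarrow> 'a \<times> bool" where
  "linv l = (fst l, \<not> snd l)"

lemma linv_simps [simp]: "linv (linv l) = l" "linv l \<noteq> l" "l \<noteq> linv l" "fst (linv l) = fst l"
  by (simp_all add: linv_def prod_eq_iff)

abbreviation freely_reduced :: "'a word \<Rightarrow> bool" where
  "freely_reduced \<equiv> successively (\<lambda>k l. l \<noteq> linv k)"

fun free_push :: "'a \<times> bool \<Rightarrow> 'a word \<Rightarrow> 'a word" where
  "free_push l [] = [l]"
| "free_push l (k # w) = (if k = linv l then w else l # k # w)"

definition free_nf :: "'a word \<Rightarrow> 'a word" where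
  "free_nf w = foldr free_push w []"

lemma freely_reduced_push: "freely_reduced w \<Longrightarrow> freely_reduced (free_push l w)"
  by (cases w) (auto simp: successively_Cons)

lemma freely_reduced_foldr: "freely_reduced w \<Longrightarrow> freely_reduced (foldr free_push u w)"
  by (induction u) (auto simp: freely_reduced_push)

text \<open>If the inner push cancels a leading \<open>l\<close>, reducedness keeps
  \<open>linv l\<close> from coming next, so the outer push puts \<open>l\<close> back. Each letter
  thus permutes the reduced words.\<close>

lemma free_push_linv: "freely_reduced w \<Longrightarrow> free_push l (free_push (linv l) w) = w"
proof (cases w)
  case (Cons k v)
  moreover assume "freely_reduced w"
  ultimately show ?thesis by (cases v) auto
qed auto

lemma free_push_reduced: "freely_reduced (l # w) \<Longrightarrow> free_push l w = l # w"
  by (cases w) auto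

text \<open>Van der Waerden's argument: words act on the reduced words by successive pushes, and a
  letter and its formal inverse act inversely, so congruent words act alike. Acting on the empty
  word then yields a normal form.\<close>

lemma foldr_free_push_cong:
  assumes "(u, v) \<in> pres_cong X {}" "freely_reduced w"
  shows "foldr free_push u w = foldr free_push v w"
  using assms
proof (induction arbitrary: w rule: pres_cong.induct)
  case (cancel x b)
  then show ?case using free_push_linv[of w "(x, b)"] by (simp add: linv_def)
next
  case (append u u' v v')
  then show ?case using freely_reduced_foldr[of w v'] by simp
qed auto

lemma free_nf_cong: "(u, v) \<in> pres_cong X {} \<Longrightarrow> free_nf u = free_nf v"
  by (simp add: free_nf_def foldr_free_push_cong)

lemma freely_reduced_nf: "freely_reduced (free_nf w)"
  by (simp add: free_nf_def freely_reduced_foldr)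

lemma free_nf_id: "freely_reduced w \<Longrightarrow> free_nf w = w"
  unfolding free_nf_def
proof (induction w)
  case (Cons l w)
  then show ?case using free_push_reduced[of l w] by (auto simp: successively_Cons)
qed simp

lemma free_push_cong:
  assumes "fst l \<in> X" "w \<in> words X"
  shows "(l # w, free_push l w) \<in> pres_cong X {}"
proof (cases "w \<noteq> [] \<and> hd w = linv l")
  case True
  then obtain v where w: "w = linv l # v" by (cases w) auto
  have "([l, linv l] @ v, [] @ v) \<in> pres_cong X {}"
    using assms w pres_cong.cancel[of "fst l" X "snd l" "{}"]
    by (intro pres_cong.append pres_cong.refl) (auto simp: linv_def)
  then show ?thesis by (simp add: w)
next
  case False
  then have "free_push l w = l # w" by (cases w) auto
  then show ?thesis using assms by (simp add: pres_cong.refl)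
qed

lemma free_nf_class: "w \<in> words X \<Longrightarrow> (w, free_nf w) \<in> pres_cong X {}"
proof (induction w)
  case Nil
  then show ?case by (simp add: free_nf_def pres_cong.refl)
next
  case (Cons l w)
  then have w: "(w, free_nf w) \<in> pres_cong X {}" and l: "fst l \<in> X" by auto
  have "([l] @ w, [l] @ free_nf w) \<in> pres_cong X {}"
    using w l by (intro pres_cong.append pres_cong.refl) auto
  moreover have "(l # free_nf w, free_push l (free_nf w)) \<in> pres_cong X {}"
    using l pres_cong_words[OF w] by (intro free_push_cong) auto
  ultimately show ?case by (auto simp: free_nf_def intro: pres_cong.trans)
qed

lemma length_free_push: "length (free_push l w) \<le> Suc (length w)"
  by (cases w) auto

lemma length_free_nf_less: "\<not> freely_reduced w \<Longrightarrow> length (free_nf w) < length w"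
proof (induction w)
  case (Cons l w)
  have c: "free_nf (l # w) = free_push l (free_nf w)" by (simp add: free_nf_def)
  show ?case
  proof (cases "freely_reduced w")
    case True
    then have "w \<noteq> []" "hd w = linv l" using Cons.prems by (auto simp: successively_Cons)
    then obtain v where w: "w = linv l # v" by (cases w) auto
    have "free_nf (l # w) = v" unfolding c free_nf_id[OF True] by (simp add: w)
    then show ?thesis by (simp add: w)
  next
    case False
    then show ?thesis using Cons.IH length_free_push[of l "free_nf w"] by (auto simp: c)
  qed
qed auto

text \<open>Reducing a word that is not reduced strictly shortens it, but the common normal form
  \<open>a @ b\<close> is as long as \<open>b @ a\<close>. So \<open>b @ a\<close> is reduced as
  well, and both words equal that normal form.\<close>

lemma free_append_commute:
  assumes nf: "free_nf (a @ b) = free_nf (b @ a)" and ab: "freely_reduced (a @ b)"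
  shows "a @ b = b @ a"
proof -
  have "freely_reduced (b @ a)"
  proof (rule ccontr)
    assume "\<not> freely_reduced (b @ a)"
    then have "length (free_nf (b @ a)) < length (b @ a)" by (rule length_free_nf_less)
    then show False using arg_cong[OF nf, of length] free_nf_id[OF ab] by simp
  qed
  then show ?thesis using nf ab by (simp add: free_nf_id)
qed

section \<open>Free group elements as classes of reduced words\<close>

lemma group_free_group: "group (free_group X)"
  unfolding free_group_def by (rule group_presented_group)

definition free_class :: "'a set \<Rightarrow> 'a word \<Rightarrow> 'a word set" where
  "free_class X w = pres_cong X {} `` {w}"

lemma free_class_carrier: "w \<in> words X \<Longrightarrow> free_class X w \<in> carrier (free_group X)"
  by (simp add: free_class_def free_group_def pres_class_carrier)

lemma free_class_append:
  "u \<in> words X \<Longrightarrow> v \<in> words X \<Longrightarrow>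
    free_class X (u @ v) = free_class X u \<otimes>\<^bsub>free_group X\<^esub> free_class X v"
  by (simp add: free_class_def free_group_def presented_group_mult)

lemma free_class_Nil: "free_class X [] = \<one>\<^bsub>free_group X\<^esub>"
  by (simp add: free_class_def free_group_def presented_group_one)

lemma free_class_eqD:
  "u \<in> words X \<Longrightarrow> v \<in> words X \<Longrightarrow> free_class X u = free_class X v \<Longrightarrow> free_nf u = free_nf v"
  by (simp add: free_class_def pres_class_eq free_nf_cong)

lemma free_class_ex:
  assumes "A \<in> carrier (free_group X)"
  obtains w where "w \<in> words X" "freely_reduced w" "A = free_class X w"
proof -
  obtain u where u: "u \<in> words X" "A = free_class X u"
    using assms by (auto simp: free_group_def presented_group_carrier_iff free_class_def)
  have c: "(u, free_nf u) \<in> pres_cong X {}" using u(1) by (rule free_nf_class)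
  then have "A = free_class X (free_nf u)"
    using u pres_cong_words[OF c] by (simp add: free_class_def pres_class_eq)
  then show thesis using that freely_reduced_nf pres_cong_words[OF c] by blast
qed

lemma free_class_replicate:
  "w \<in> words X \<Longrightarrow> concat (replicate m w) \<in> words X \<and>
    free_class X (concat (replicate m w)) = free_class X w [^]\<^bsub>free_group X\<^esub> m"
proof (induction m)
  case 0
  then show ?case using group.is_monoid[OF group_free_group[of X]]
    by (simp add: free_class_Nil monoid.nat_pow_0)
next
  case (Suc m)
  interpret group "free_group X" by (rule group_free_group)
  show ?case
    using Suc free_class_carrier[OF Suc.prems] nat_pow_Suc2[of "free_class X w" m]
    by (simp add: free_class_append del: nat_pow_Suc)
qed

lemma free_class_word_inv:
  assumes "w \<in> words X"
  shows "free_class X (word_inv w) = inv\<^bsub>free_group X\<^esub> (free_class X w)"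
proof -
  interpret group "free_group X" by (rule group_free_group)
  have "free_class X (word_inv w) \<otimes>\<^bsub>free_group X\<^esub> free_class X w = \<one>\<^bsub>free_group X\<^esub>"
    using word_inv_left[OF assms, of "{}"] assms
    by (simp add: free_class_append[symmetric] free_class_Nil[symmetric])
      (simp add: free_class_def pres_class_eq)
  then show ?thesis using assms by (intro inv_equality[symmetric] free_class_carrier) auto
qed

lemma freely_reduced_word_inv: "freely_reduced w \<Longrightarrow> freely_reduced (word_inv w)"
proof -
  have "word_inv w = rev (map linv w)" by (simp add: word_inv_def linv_def[abs_def])
  moreover assume "freely_reduced w"
  then have "successively (\<lambda>k l. linv k \<noteq> l) w" by (rule successively_mono) auto
  ultimately show ?thesis by (simp add: successively_map eq_commute)
qed

text \<open>Nothing cancels where \<open>a\<close> meets \<open>b\<close>, so the words commute in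
  the free monoid and are powers of one word: \<open>a\<close> is \<open>z\<close> repeated
  \<open>m\<close> times, \<open>b\<close> is \<open>z\<close> repeated \<open>n\<close> times. The
  exponents \<open>n\<close> for \<open>a\<close> and \<open>m\<close> for \<open>b\<close> then
  agree.\<close>

lemma free_commute_powers_append:
  assumes words: "a \<in> words X" "b \<in> words X" and red: "freely_reduced a" "freely_reduced b"
    and ne: "a \<noteq> []" "b \<noteq> []"
    and comm: "free_class X (a @ b) = free_class X (b @ a)" and hd: "hd b \<noteq> linv (last a)"
  shows "\<exists>(k::nat) (l::nat). k > 0 \<and>
    free_class X a [^]\<^bsub>free_group X\<^esub> k = free_class X b [^]\<^bsub>free_group X\<^esub> l"
proof -
  interpret group "free_group X" by (rule group_free_group)
  have "free_nf (a @ b) = free_nf (b @ a)" using comm words by (intro free_class_eqD) auto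
  then have "a @ b = b @ a"
    using red hd by (intro free_append_commute) (auto simp: successively_append_iff)
  then obtain m n z where z: "concat (replicate m z) = a" "concat (replicate n z) = b"
    using comm_append_are_replicate by blast
  have mn: "m > 0" "n > 0" using z ne by (auto intro: gr0I)
  have zX: "z \<in> words X" using z(1) words(1) mn by (cases m) auto
  have "free_class X a = free_class X z [^]\<^bsub>free_group X\<^esub> m"
    "free_class X b = free_class X z [^]\<^bsub>free_group X\<^esub> n"
    using free_class_replicate[OF zX] z by metis+
  then have "free_class X a [^]\<^bsub>free_group X\<^esub> n = free_class X b [^]\<^bsub>free_group X\<^esub> m"
    using free_class_carrier[OF zX] by (simp add: nat_pow_pow mult.commute)
  then show ?thesis using mn(2) by blast
qed

text \<open>If \<open>b\<close> did not start with \<open>x\<close>, nothing would cancel in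
  \<open>a @ b\<close>, so the words would commute literally and share their first letter. The last
  letter is treated the same way with \<open>b @ a\<close>. Taking \<open>b\<close> to be
  \<open>a\<close> itself gives the shape of \<open>a\<close>.\<close>

lemma free_commute_ends:
  assumes nf: "free_nf (a @ b) = free_nf (b @ a)"
    and red: "freely_reduced a" "freely_reduced b" and ne: "a \<noteq> []" "b \<noteq> []"
    and ends: "hd a = x" "last a = linv x"
  obtains c where "b = x # c @ [linv x]" "freely_reduced c" "c \<noteq> []"
proof -
  have h: "hd b = x"
  proof (rule ccontr)
    assume neq: "hd b \<noteq> x"
    then have "a @ b = b @ a" using nf red ends
      by (intro free_append_commute) (auto simp: successively_append_iff)
    then have "hd (a @ b) = hd (b @ a)" by simp
    then show False using ne ends neq by simp
  qed
  have l: "last b = linv x"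
  proof (rule ccontr)
    assume neq: "last b \<noteq> linv x"
    then have "hd a \<noteq> linv (last b)" using ends by auto
    then have "b @ a = a @ b" using nf red
      by (intro free_append_commute) (auto simp: successively_append_iff)
    then have "last (b @ a) = last (a @ b)" by simp
    then show False using ne ends neq by simp
  qed
  obtain d where d: "b = x # d" using ne h by (cases b) auto
  then have "d \<noteq> []" using l by auto
  then obtain c where c: "b = x # c @ [linv x]" using d l by (cases d rule: rev_cases) auto
  moreover have "c \<noteq> []" using red(2) c by auto
  ultimately show thesis
    using that red(2) by (auto simp: successively_Cons successively_append_iff)
qed

section \<open>Conjugation, and common powers of commuting words\<close>

lemma (in group) conj_hom: "x \<in> carrier G \<Longrightarrow> (\<lambda>y. x \<otimes> y \<otimes> inv x) \<in> hom G G"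
  by (intro homI) (simp_all add: m_assoc inv_solve_left)

lemma (in group) conj_eq_one_iff:
  "x \<in> carrier G \<Longrightarrow> v \<in> carrier G \<Longrightarrow> x \<otimes> v \<otimes> inv x = \<one> \<longleftrightarrow> v = \<one>"
  by (simp add: inv_solve_right')

lemma free_commute_words:
  assumes "a \<in> words X" "b \<in> words X" "freely_reduced a" "freely_reduced b" "a \<noteq> []" "b \<noteq> []"
    and "free_class X (a @ b) = free_class X (b @ a)"
  shows "\<exists>(k::nat) (l::int). k > 0 \<and>
    free_class X a [^]\<^bsub>free_group X\<^esub> k = free_class X b [^]\<^bsub>free_group X\<^esub> l"
  using assms
  \<comment> \<open>Either both words are conjugates by the same letter, or no letters cancel in \<open>a @ b\<close> or
    in \<open>a @ word_inv b\<close>, so that the two words commute in the free monoid.\<close>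
proof (induction "length a" arbitrary: a b rule: less_induct)
  case less
  interpret group "free_group X" by (rule group_free_group)
  note car = free_class_carrier[of _ X]
  have nf: "free_nf (a @ b) = free_nf (b @ a)"
    using less.prems by (intro free_class_eqD) auto
  show ?case
  proof (cases "last a = linv (hd a) \<or> last b = linv (hd b)")
    case True
    have "\<exists>x a' b'. a = x # a' @ [linv x] \<and> b = x # b' @ [linv x] \<and> a' \<noteq> [] \<and> b' \<noteq> []
      \<and> freely_reduced a' \<and> freely_reduced b'"
      using True
    proof
      assume "last a = linv (hd a)"
      then show ?thesis
        using free_commute_ends[of a a "hd a"] free_commute_ends[OF nf, of "hd a"] less.prems by metis
    next
      assume "last b = linv (hd b)"
      then show ?thesis
        using free_commute_ends[of b b "hd b"] free_commute_ends[OF nf[symmetric], of "hd b"] less.prems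
        by metis
    qed
    then obtain x a' b' where ab: "a = x # a' @ [linv x]" "b = x # b' @ [linv x]"
      "a' \<noteq> []" "b' \<noteq> []" "freely_reduced a'" "freely_reduced b'" by blast
    define Y where "Y = free_class X [x]"
    have X: "fst x \<in> X" "a' \<in> words X" "b' \<in> words X" using less.prems ab by auto
    have Y: "Y \<in> carrier (free_group X)" using X car by (simp add: Y_def)
    have invY: "free_class X [linv x] = inv\<^bsub>free_group X\<^esub> Y"
      using free_class_word_inv[of "[x]" X] X by (simp add: word_inv_def linv_def Y_def)
    define conj where "conj A = Y \<otimes>\<^bsub>free_group X\<^esub> A \<otimes>\<^bsub>free_group X\<^esub> inv\<^bsub>free_group X\<^esub> Y" for A
    have conj: "free_class X (x # w @ [linv x]) = conj (free_class X w)" if "w \<in> words X" for w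
      using free_class_append[of "[x] @ w" X "[linv x]"] free_class_append[of "[x]" X w] that X
      by (simp add: invY conj_def Y_def)
    have hom: "conj \<in> hom (free_group X) (free_group X)"
      using conj_hom[OF Y] by (simp add: conj_def[abs_def])
    interpret conj: group_hom "free_group X" "free_group X" conj
      using hom by unfold_locales
    let ?A = "free_class X a'" and ?B = "free_class X b'"
    have AB: "?A \<in> carrier (free_group X)" "?B \<in> carrier (free_group X)" using X car by auto
    have "conj (?A \<otimes>\<^bsub>free_group X\<^esub> ?B) = conj (?B \<otimes>\<^bsub>free_group X\<^esub> ?A)"
      using less.prems ab X conj[of a'] conj[of b'] AB free_class_append[of a X b]
        free_class_append[of b X a] by simp
    \<comment> \<open>Conjugation is injective, so the shorter inner words commute and the induction
      hypothesis applies to them.\<close>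
    then have "?A \<otimes>\<^bsub>free_group X\<^esub> ?B = ?B \<otimes>\<^bsub>free_group X\<^esub> ?A"
      using Y AB by (simp add: conj_def)
    then have "free_class X (a' @ b') = free_class X (b' @ a')"
      using X by (simp add: free_class_append)
    then obtain k :: nat and l :: int where "k > 0"
      "?A [^]\<^bsub>free_group X\<^esub> k = ?B [^]\<^bsub>free_group X\<^esub> l"
      using less.hyps[of a' b'] ab X by auto
    moreover from this have "conj ?A [^]\<^bsub>free_group X\<^esub> k = conj ?B [^]\<^bsub>free_group X\<^esub> l"
      using AB conj.hom_nat_pow[of ?A k] conj.hom_int_pow[of ?B l] by simp
    ultimately show ?thesis using conj X ab by metis
  next
    case False
    show ?thesis
    proof (cases "hd b = linv (last a)")
      case False
      then obtain k l :: nat where "k > 0"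
        "free_class X a [^]\<^bsub>free_group X\<^esub> k = free_class X b [^]\<^bsub>free_group X\<^esub> l"
        using free_commute_powers_append[of a X b] less.prems by blast
      then show ?thesis by (metis int_pow_int)
    next
      case True
      have b: "word_inv b \<in> words X" "freely_reduced (word_inv b)" "word_inv b \<noteq> []"
        using less.prems freely_reduced_word_inv[of b] by simp_all (simp add: word_inv_def)
      have "hd (word_inv b) = linv (last b)"
        using less.prems by (simp add: word_inv_def hd_rev last_map linv_def)
      \<comment> \<open>Equality would give \<open>hd b = linv (last b)\<close>, which this case
        excludes. Inverting \<open>b\<close> brings its other end to the junction, where nothing
        cancels.\<close>
      moreover have "last b \<noteq> last a" using True False by (metis linv_simps(1))
      ultimately have hd: "hd (word_inv b) \<noteq> linv (last a)" by (metis linv_simps(1))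
      have "free_class X (a @ word_inv b) = free_class X (word_inv b @ a)"
        using less.prems car b(1)
        by (simp add: free_class_append free_class_word_inv)
          (metis inv_solve_left inv_solve_right m_assoc inv_closed m_closed)
      then obtain k l :: nat where k: "k > 0"
        "free_class X a [^]\<^bsub>free_group X\<^esub> k = free_class X (word_inv b) [^]\<^bsub>free_group X\<^esub> l"
        using free_commute_powers_append[of a X "word_inv b"] less.prems b hd by blast
      \<comment> \<open>Undoing the inversion makes the exponent negative, which is why
        \<open>l\<close> ranges over the integers.\<close>
      then have "free_class X a [^]\<^bsub>free_group X\<^esub> k = free_class X b [^]\<^bsub>free_group X\<^esub> (- int l)"
        using less.prems car by (simp add: free_class_word_inv int_pow_neg_int nat_pow_inv)
      then show ?thesis using k(1) by blast
    qed
  qed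
qed

lemma free_group_commute_powers:
  assumes "A \<in> carrier (free_group X)" "B \<in> carrier (free_group X)"
    and "A \<noteq> \<one>\<^bsub>free_group X\<^esub>" "B \<noteq> \<one>\<^bsub>free_group X\<^esub>"
    and "A \<otimes>\<^bsub>free_group X\<^esub> B = B \<otimes>\<^bsub>free_group X\<^esub> A"
  shows "\<exists>(k::nat) (l::int). k > 0 \<and> A [^]\<^bsub>free_group X\<^esub> k = B [^]\<^bsub>free_group X\<^esub> l"
proof -
  obtain a where a: "a \<in> words X" "freely_reduced a" "A = free_class X a"
    using assms(1) by (rule free_class_ex)
  obtain b where b: "b \<in> words X" "freely_reduced b" "B = free_class X b"
    using assms(2) by (rule free_class_ex)
  show ?thesis
    unfolding a(3) b(3)
    by (rule free_commute_words) (use a b assms in \<open>auto simp: free_class_append free_class_Nil\<close>)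
qed

section \<open>Reduced words in the twin groups\<close>

definition far :: "nat \<Rightarrow> nat \<Rightarrow> bool" where
  "far x y \<longleftrightarrow> Suc x < y \<or> Suc y < x"

text \<open>Expresses that commutations can bring an occurrence of \<open>s\<close> to the front of
  the word.\<close>

fun front :: "nat \<Rightarrow> nat list \<Rightarrow> bool" where
  "front s [] \<longleftrightarrow> False"
| "front s (x # w) \<longleftrightarrow> x = s \<or> far x s \<and> front s w"

text \<open>Reducedness as in a right-angled Coxeter group: no letter can be moved by commutations
  next to a later equal letter.\<close>

fun twin_reduced :: "nat list \<Rightarrow> bool" where
  "twin_reduced [] \<longleftrightarrow> True"
| "twin_reduced (x # w) \<longleftrightarrow> \<not> front x w \<and> twin_reduced w"

definition proj :: "nat list \<Rightarrow> nat \<Rightarrow> nat list" where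
  "proj w i = filter (\<lambda>x. x = i \<or> Suc x = i) w"

text \<open>The letter \<open>s\<close> occurs only in the projections with indices \<open>s\<close> and \<open>Suc s\<close>. It can be shuffled
  to the front of a word iff it is the head of both, so left multiplication by \<open>s\<close> can be computed
  on the projections, where words that differ by commutations become equal.\<close>

definition twin_push :: "nat \<Rightarrow> (nat \<Rightarrow> nat list) \<Rightarrow> nat \<Rightarrow> nat list" where
  "twin_push s f i =
    (if i = s \<or> i = Suc s then
       if (\<exists>u. f s = s # u) \<and> (\<exists>v. f (Suc s) = s # v) then tl (f i) else s # f i
     else f i)"

lemma far_iff_abs: "far x y \<longleftrightarrow> 2 \<le> \<bar>int x - int y\<bar>"
  by (auto simp: far_def)

text \<open>The letters that block \<open>s\<close> are its neighbours: the lower one is visible in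
  the projection at \<open>s\<close>, the upper one in that at \<open>Suc s\<close>. Heading both
  lists means that neither precedes the first \<open>s\<close>.\<close>

lemma front_iff_proj: "front s w \<longleftrightarrow> (\<exists>u. proj w s = s # u) \<and> (\<exists>v. proj w (Suc s) = s # v)"
  by (induction w) (auto simp: proj_def far_def)

lemma proj_remove1:
  "front s w \<Longrightarrow> proj (remove1 s w) i = (if i = s \<or> i = Suc s then tl (proj w i) else proj w i)"
  by (induction w) (auto simp: proj_def far_def)

lemma twin_push_front: "front s w \<Longrightarrow> twin_push s (proj w) = proj (remove1 s w)"
  by (rule ext) (simp add: twin_push_def proj_remove1 front_iff_proj)

lemma twin_push_not_front: "\<not> front s w \<Longrightarrow> twin_push s (proj w) = proj (s # w)"
  by (rule ext) (auto simp: twin_push_def front_iff_proj proj_def)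

text \<open>A second \<open>s\<close> that could still reach the front could also reach the removed
  one, so the two would have cancelled.\<close>

lemma not_front_remove1: "front s w \<Longrightarrow> twin_reduced w \<Longrightarrow> \<not> front s (remove1 s w)"
  by (induction w) (auto simp: far_def)

lemma front_remove1_far: "front s w \<Longrightarrow> far x s \<Longrightarrow> front x (remove1 s w) \<longleftrightarrow> front x w"
  by (induction w) (auto simp: far_def)

lemma twin_reduced_remove1: "front s w \<Longrightarrow> twin_reduced w \<Longrightarrow> twin_reduced (remove1 s w)"
  by (induction w) (auto simp: front_remove1_far)

text \<open>On arbitrary families of lists two pushes of \<open>s\<close> may delete two letters; on
  projections of reduced words a push is an involution.\<close>

definition twin_states :: "(nat \<Rightarrow> nat list) set" where
  "twin_states = proj ` {w. twin_reduced w}"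

lemma twin_push_states:
  assumes "f \<in> twin_states"
  shows "twin_push s f \<in> twin_states"
proof -
  obtain w where w: "f = proj w" "twin_reduced w" using assms by (auto simp: twin_states_def)
  show ?thesis
  proof (cases "front s w")
    case True
    then show ?thesis using w twin_reduced_remove1[of s w]
      by (auto simp: twin_push_front twin_states_def)
  next
    case False
    then have "twin_reduced (s # w)" using w by simp
    then show ?thesis using w False
      by (auto simp: twin_push_not_front twin_states_def simp del: twin_reduced.simps)
  qed
qed

lemma foldr_twin_push_states: "f \<in> twin_states \<Longrightarrow> foldr twin_push w f \<in> twin_states"
  by (induction w) (auto simp: twin_push_states)

text \<open>Removing \<open>s\<close> and prepending it again may change the order of the letters in
  the word, but not its projections.\<close>

lemma twin_push_twice:
  assumes "f \<in> twin_states"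
  shows "twin_push s (twin_push s f) = f"
proof -
  obtain w where w: "f = proj w" "twin_reduced w" using assms by (auto simp: twin_states_def)
  show ?thesis
  proof (cases "front s w")
    case True
    then have "twin_push s (twin_push s f) = proj (s # remove1 s w)"
      using w not_front_remove1 by (simp add: twin_push_front twin_push_not_front)
    also have "\<dots> = proj w"
      using True front_iff_proj[of s w] proj_remove1[OF True] by (auto simp: fun_eq_iff proj_def)
    finally show ?thesis using w by simp
  next
    case False
    then show ?thesis using w by (simp add: twin_push_front twin_push_not_front)
  qed
qed

lemma twin_push_other: "i \<noteq> s \<Longrightarrow> i \<noteq> Suc s \<Longrightarrow> twin_push s f i = f i"
  by (simp add: twin_push_def)

lemma twin_push_local:
  "f s = g s \<Longrightarrow> f (Suc s) = g (Suc s) \<Longrightarrow> i = s \<or> i = Suc s \<Longrightarrow> twin_push s f i = twin_push s g i"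
  by (auto simp: twin_push_def)

text \<open>A push of \<open>s\<close> reads and changes only the lists at \<open>s\<close> and
  \<open>Suc s\<close>; for far letters these pairs of indices are disjoint.\<close>

lemma twin_push_commute:
  assumes "far s t"
  shows "twin_push s (twin_push t f) = twin_push t (twin_push s f)"
proof (rule ext)
  fix i
  have s: "twin_push s (twin_push t f) j = twin_push s f j" if "j = s \<or> j = Suc s" for j
    using assms that by (intro twin_push_local) (auto simp: far_def twin_push_other)
  have t: "twin_push t (twin_push s f) j = twin_push t f j" if "j = t \<or> j = Suc t" for j
    using assms that by (intro twin_push_local) (auto simp: far_def twin_push_other)
  consider "i = s \<or> i = Suc s" "i \<noteq> t" "i \<noteq> Suc t" | "i = t \<or> i = Suc t" "i \<noteq> s" "i \<noteq> Suc s"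
    | "i \<noteq> s" "i \<noteq> Suc s" "i \<noteq> t" "i \<noteq> Suc t"
    using assms unfolding far_def by linarith
  then show "twin_push s (twin_push t f) i = twin_push t (twin_push s f) i"
    by cases (simp_all add: s t twin_push_other)
qed

lemma foldr_twin_push_cong:
  assumes "(u, v) \<in> pres_cong {1..n - 1} (twin_relations n)" "f \<in> twin_states"
  shows "foldr twin_push (map fst u) f = foldr twin_push (map fst v) f"
  using assms
proof (induction arbitrary: f rule: pres_cong.induct)
  case (cancel x b)
  then show ?case by (simp add: twin_push_twice)
next
  case (rel u v)
  then show ?case
    by (auto simp: twin_relations_def twin_push_twice far_iff_abs intro!: twin_push_commute)
next
  case (append u u' v v')
  then show ?case using foldr_twin_push_states[of f "map fst v'"] by simp
qed auto

lemma foldr_twin_push_reduced: "twin_reduced w \<Longrightarrow> foldr twin_push w (proj []) = proj w"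
  by (induction w) (auto simp: twin_push_not_front)

section \<open>Twin group elements as classes of positive words\<close>

definition twin_class :: "nat \<Rightarrow> nat list \<Rightarrow> nat word set" where
  "twin_class n w = pres_cong {1..n - 1} (twin_relations n) `` {map (\<lambda>i. (i, True)) w}"

lemma positive_words [simp]: "map (\<lambda>i. (i, True)) w \<in> words X \<longleftrightarrow> set w \<subseteq> X"
  by (induction w) auto

lemma group_twin_group: "group (twin_group n)"
  unfolding twin_group_def by (rule group_presented_group)

lemma twin_class_carrier: "set w \<subseteq> {1..n - 1} \<Longrightarrow> twin_class n w \<in> carrier (twin_group n)"
  by (simp add: twin_class_def twin_group_def pres_class_carrier)

lemma twin_class_append:
  "set u \<subseteq> {1..n - 1} \<Longrightarrow> set v \<subseteq> {1..n - 1} \<Longrightarrow>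
    twin_class n (u @ v) = twin_class n u \<otimes>\<^bsub>twin_group n\<^esub> twin_class n v"
  by (simp add: twin_class_def twin_group_def presented_group_mult)

lemma twin_class_Nil: "twin_class n [] = \<one>\<^bsub>twin_group n\<^esub>"
  by (simp add: twin_class_def twin_group_def presented_group_one)

lemma twin_class_reduced_eq_one:
  assumes "set w \<subseteq> {1..n - 1}" "twin_reduced w" "twin_class n w = \<one>\<^bsub>twin_group n\<^esub>"
  shows "w = []"
proof -
  have "(map (\<lambda>i. (i, True)) w, []) \<in> pres_cong {1..n - 1} (twin_relations n)"
    using assms by (simp add: twin_class_Nil[symmetric]) (simp add: twin_class_def pres_class_eq)
  moreover have "proj [] \<in> twin_states" by (auto simp: twin_states_def)
  ultimately have "proj w = proj []"
    using foldr_twin_push_cong foldr_twin_push_reduced[OF assms(2)] by (fastforce simp: comp_def)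
  \<comment> \<open>A nonempty word has its own first letter in this projection.\<close>
  then have "proj w (hd w) = []" by (simp add: proj_def)
  then show ?thesis by (cases w) (auto simp: proj_def)
qed

lemma twin_class_rel:
  assumes "(map (\<lambda>i. (i, True)) u, map (\<lambda>i. (i, True)) v) \<in> twin_relations n"
    and "set u \<subseteq> {1..n - 1}" "set v \<subseteq> {1..n - 1}"
  shows "twin_class n u = twin_class n v"
  unfolding twin_class_def using assms by (subst pres_class_eq) (auto intro: pres_cong.rel)

lemma twin_class_double:
  assumes "i \<in> {1..n - 1}"
  shows "twin_class n [i, i] = \<one>\<^bsub>twin_group n\<^esub>"
  unfolding twin_class_Nil[symmetric]
  by (rule twin_class_rel) (use assms in \<open>auto simp: twin_relations_def\<close>)

lemma twin_class_swap:
  assumes "i \<in> {1..n - 1}" "j \<in> {1..n - 1}" "far i j"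
  shows "twin_class n [i, j] = twin_class n [j, i]"
  by (rule twin_class_rel) (use assms in \<open>auto simp: twin_relations_def far_iff_abs\<close>)

lemma twin_class_shift:
  assumes "set m \<subseteq> {1..n - 1}" "s \<in> {1..n - 1}" "\<forall>x\<in>set m. far x s"
  shows "twin_class n (m @ [s]) = twin_class n (s # m)"
  using assms
proof (induction m)
  case (Cons x m)
  interpret group "twin_group n" by (rule group_twin_group)
  have "twin_class n ((x # m) @ [s]) = twin_class n [x] \<otimes>\<^bsub>twin_group n\<^esub> twin_class n (s # m)"
    using Cons twin_class_append[of "[x]" n "m @ [s]"] by simp
  also have "\<dots> = twin_class n [x, s] \<otimes>\<^bsub>twin_group n\<^esub> twin_class n m"
    using Cons twin_class_append[of "[x]" n "s # m"] twin_class_append[of "[x, s]" n m] by simp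
  also have "\<dots> = twin_class n (s # x # m)"
    using Cons twin_class_swap[of x n s] twin_class_append[of "[s, x]" n m] by simp
  finally show ?case .
qed auto

text \<open>Generators are involutions, so each formal inverse can be replaced by its
  generator.\<close>

lemma twin_class_ex:
  assumes "A \<in> carrier (twin_group n)"
  obtains w where "set w \<subseteq> {1..n - 1}" "A = twin_class n w"
proof -
  let ?C = "pres_cong {1..n - 1} (twin_relations n)"
  have "(u, map (\<lambda>l. (fst l, True)) u) \<in> ?C" if "u \<in> words {1..n - 1}" for u
    using that
  proof (induction u)
    case Nil
    then show ?case by (simp add: pres_cong.refl)
  next
    case (Cons l u)
    obtain x b where l: "l = (x, b)" by fastforce
    have x: "x \<in> {1..n - 1}" using Cons l by simp
    have "([(x, False)], [(x, True)]) \<in> ?C"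
    proof -
      \<comment> \<open>The inverse of \<open>x\<close> followed by \<open>x x\<close> equals that
        inverse by the involution relation, and equals \<open>x\<close> by free
        cancellation.\<close>
      have "([(x, False)] @ [(x, True), (x, True)], [(x, False)] @ []) \<in> ?C"
        using x by (intro pres_cong.append pres_cong.refl pres_cong.rel) (auto simp: twin_relations_def)
      moreover have "([(x, False), (x, True)] @ [(x, True)], [] @ [(x, True)]) \<in> ?C"
        using x pres_cong.cancel[of x _ False] by (intro pres_cong.append pres_cong.refl) auto
      ultimately show ?thesis using pres_cong.sym pres_cong.trans by fastforce
    qed
    then have "([l], [(x, True)]) \<in> ?C"
      using x l by (cases b) (auto intro: pres_cong.refl)
    then show ?case using pres_cong.append[OF _ Cons.IH, of "[l]" "[(x, True)]"] Cons.prems l by simp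
  qed
  moreover obtain u where u: "u \<in> words {1..n - 1}" "A = ?C `` {u}"
    using assms by (auto simp: twin_group_def presented_group_carrier_iff)
  ultimately have c: "(u, map (\<lambda>i. (i, True)) (map fst u)) \<in> ?C" by (simp add: comp_def)
  then have s: "set (map fst u) \<subseteq> {1..n - 1}" using pres_cong_words[OF c] by (simp only: positive_words)
  have "A = twin_class n (map fst u)"
    unfolding twin_class_def u(2) using pres_cong_words[OF c] c by (simp only: pres_class_eq)
  then show thesis by (rule that[OF s])
qed

section \<open>Torsion in the pure twin groups\<close>

lemma front_append: "front s (u @ v) \<longleftrightarrow> front s u \<or> (\<forall>x\<in>set u. far x s) \<and> front s v"
  by (induction u) auto

lemma frontE:
  assumes "front s w"
  obtains p q where "w = p @ s # q" "\<forall>x\<in>set p. far x s"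
proof -
  have "\<exists>p q. w = p @ s # q \<and> (\<forall>x\<in>set p. far x s)"
    using assms
  proof (induction w)
    case (Cons x w)
    show ?case
    proof (cases "x = s")
      case True
      then have "x # w = [] @ s # w" by simp
      then show ?thesis by (metis empty_iff list.set(1))
    next
      case False
      then obtain p q where "w = p @ s # q" "\<forall>x\<in>set p. far x s" using Cons by auto
      moreover from this have "x # w = (x # p) @ s # q" by simp
      ultimately show ?thesis using Cons.prems False by (metis front.simps(2) set_ConsD)
    qed
  qed auto
  then show thesis using that by blast
qed

lemma not_twin_reducedE:
  assumes "\<not> twin_reduced w"
  obtains p s m q where "w = p @ s # m @ s # q" "\<forall>x\<in>set m. far x s"
proof -
  have "\<exists>p s m q. w = p @ s # m @ s # q \<and> (\<forall>x\<in>set m. far x s)"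
    using assms
  proof (induction w)
    case (Cons x w)
    show ?case
    proof (cases "front x w")
      case True
      then obtain m q where "w = m @ x # q" "\<forall>y\<in>set m. far y x" by (rule frontE)
      moreover from this have "x # w = [] @ x # m @ x # q" by simp
      ultimately show ?thesis by blast
    next
      case False
      then obtain p s m q where "w = p @ s # m @ s # q" "\<forall>x\<in>set m. far x s" using Cons by auto
      moreover from this have "x # w = (x # p) @ s # m @ s # q" by simp
      ultimately show ?thesis by blast
    qed
  qed auto
  then show thesis using that by blast
qed

lemma twin_reduced_suffix: "twin_reduced (p @ q) \<Longrightarrow> twin_reduced q"
  by (induction p) auto

lemma not_far_self [simp]: "\<not> far x x"
  by (simp add: far_def)

lemma split_first_unique:
  "a @ x # c = b @ x # d \<Longrightarrow> x \<notin> set a \<Longrightarrow> x \<notin> set b \<Longrightarrow> a = b \<and> c = d"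
proof (induction a arbitrary: b)
  case Nil
  then show ?case by (cases b) auto
next
  case (Cons y a)
  then show ?case by (cases b) auto
qed

text \<open>A cancelling pair of letters \<open>x\<close> in a power would have to join two
  consecutive copies of \<open>w\<close>: one \<open>x\<close> can move to the end of
  \<open>w\<close>, one to its beginning. Distinct occurrences contradict \<open>cyc\<close>; if
  they coincide, \<open>x\<close> commutes with all other letters, contrary to
  \<open>adj\<close>.\<close>

lemma twin_reduced_power:
  assumes red: "twin_reduced w"
    and cyc: "\<And>m x r u. w = m @ x # r @ x # u \<Longrightarrow> \<forall>y\<in>set m \<union> set u. far y x \<Longrightarrow> False"
    and adj: "\<And>x. x \<in> set w \<Longrightarrow> \<exists>y\<in>set w. y \<noteq> x \<and> \<not> far y x"
  shows "twin_reduced (concat (replicate k w))"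
proof (induction k)
  case (Suc k)
  \<comment> \<open>The next copy of \<open>w\<close> is added letter by letter, hence the claim for
    all suffixes \<open>u\<close>.\<close>
  have "twin_reduced (u @ concat (replicate k w))" if "w = p @ u" for p u
    using that
  proof (induction u arbitrary: p)
    case Nil
    then show ?case using Suc by simp
  next
    case (Cons x u)
    have red': "twin_reduced (u @ concat (replicate k w))" using Cons.IH[of "p @ [x]"] Cons.prems by simp
    have "\<not> front x u" using twin_reduced_suffix[of p "x # u"] red Cons.prems by simp
    moreover have False if u: "\<forall>y\<in>set u. far y x" and f: "front x (concat (replicate k w))"
    proof -
      have x: "x \<in> set w" using Cons.prems by simp
      obtain j where k: "k = Suc j" using f by (cases k) auto
      \<comment> \<open>The partner of \<open>x\<close> lies in the next copy: to come from beyond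
        it, it would have to pass the \<open>x\<close> occurring there.\<close>
      then have "front x w" using f x by (auto simp: front_append)
      then obtain m q where m: "w = m @ x # q" "\<forall>y\<in>set m. far y x" by (rule frontE)
      have eq: "m @ x # q = p @ x # u" using m Cons.prems by simp
      have xm: "x \<notin> set m" using m(2) by auto
      show False
      proof (cases "x \<in> set p")
        case False
        then have "m = p \<and> q = u" using split_first_unique[OF eq xm] by simp
        then show False using adj[OF x] m u by auto
      next
        case True
        then obtain m' r where p: "p = m' @ x # r" "x \<notin> set m'" by (meson split_list_first)
        then have "m @ x # q = m' @ x # (r @ x # u)" using eq by simp
        then have "m = m'" using split_first_unique[of m x q m' "r @ x # u"] xm p(2) by simp
        then show False using cyc[of m x r u] p Cons.prems m u by auto
      qed
    qed
    ultimately show ?case using red' by (auto simp: front_append)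
  qed
  from this[of "[]" w] show ?case by simp
qed auto

lemma front_if_isolated: "x \<in> set w \<Longrightarrow> \<forall>y\<in>set w. y \<noteq> x \<longrightarrow> far y x \<Longrightarrow> front x w"
  by (induction w) auto

lemma twin_class_replicate:
  assumes "set w \<subseteq> {1..n - 1}"
  shows "twin_class n (concat (replicate k w)) = twin_class n w [^]\<^bsub>twin_group n\<^esub> k"
proof (induction k)
  case 0
  interpret group "twin_group n" by (rule group_twin_group)
  show ?case by (simp add: twin_class_Nil)
next
  case (Suc k)
  interpret group "twin_group n" by (rule group_twin_group)
  have "set (concat (replicate k w)) \<subseteq> {1..n - 1}" using assms by auto
  then show ?case
    using Suc assms twin_class_carrier[OF assms] nat_pow_Suc2[of "twin_class n w" k]
    by (simp add: twin_class_append del: nat_pow_Suc)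
qed

section \<open>Permutations of words, and torsion\<close>

lemma twin_perm_class:
  assumes "set w \<subseteq> {1..n - 1}"
  shows "twin_perm n (twin_class n w) = foldr (\<lambda>i p. transpose i (i + 1) \<circ> p) w id"
proof -
  have "twin_perm n (twin_class n w)
    = word_eval (sym_group n) (\<lambda>i. transpose i (i + 1)) (map (\<lambda>i. (i, True)) w)"
    unfolding twin_perm_def twin_class_def
    using assms transpose_twin_relations
    by (intro group.pres_lift_class[OF sym_group_is_group transpose_sym_group]) auto
  also have "\<dots> = foldr (\<lambda>i p. transpose i (i + 1) \<circ> p) w id"
    by (induction w) (auto simp: word_eval_def letter_eval_def sym_group_mult sym_group_one)
  finally show ?thesis .
qed

lemma twin_perm_far:
  assumes "\<forall>y\<in>set w. far y x"
  shows "foldr (\<lambda>i p. transpose i (i + 1) \<circ> p) w id x = x"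
    "foldr (\<lambda>i p. transpose i (i + 1) \<circ> p) w id (Suc x) = Suc x"
  using assms by (induction w) (auto simp: far_def transpose_def)

lemma foldr_transpose_append:
  "foldr (\<lambda>i p. transpose i (i + 1) \<circ> p) (u @ v) id
    = foldr (\<lambda>i p. transpose i (i + 1) \<circ> p) u id \<circ> foldr (\<lambda>i p. transpose i (i + 1) \<circ> p) v id"
  by (induction u) auto

text \<open>Letters far from \<open>x\<close> fix both \<open>x\<close> and \<open>Suc x\<close>, so
  only the single transposition at \<open>x\<close> acts.\<close>

lemma twin_perm_isolated:
  assumes "\<forall>y\<in>set p \<union> set q. far y x"
  shows "foldr (\<lambda>i p. transpose i (i + 1) \<circ> p) (p @ x # q) id x = Suc x"
  unfolding foldr_transpose_append using assms twin_perm_far[of p x] twin_perm_far[of q x] by simp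

lemma twin_class_torsion:
  assumes "set w \<subseteq> {1..n - 1}" "twin_perm n (twin_class n w) = \<one>\<^bsub>sym_group n\<^esub>" "k > 0"
    and "twin_class n w [^]\<^bsub>twin_group n\<^esub> (k::nat) = \<one>\<^bsub>twin_group n\<^esub>"
  shows "twin_class n w = \<one>\<^bsub>twin_group n\<^esub>"
  using assms
proof (induction "length w" arbitrary: w rule: less_induct)
  case less
  interpret group "twin_group n" by (rule group_twin_group)
  interpret perm: group_hom "twin_group n" "sym_group n" "twin_perm n"
    using twin_perm_hom sym_group_is_group group_twin_group
    by (simp add: group_hom_def group_hom_axioms_def)
  note w = less.prems(1)
  consider (red) p s m q where "w = p @ s # m @ s # q" "\<forall>x\<in>set m. far x s"
    | (cyc) m x r u where "w = m @ x # r @ x # u" "\<forall>y\<in>set m \<union> set u. far y x"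
    | (iso) x where "twin_reduced w" "x \<in> set w" "\<forall>y\<in>set w. y \<noteq> x \<longrightarrow> far y x"
    | (power) "twin_reduced (concat (replicate k w))"
  proof (cases "twin_reduced w")
    case True
    \<comment> \<open>If the cases \<open>cyc\<close> and \<open>iso\<close> fail, their negations
      are the hypotheses of \<open>twin_reduced_power\<close>.\<close>
    have "twin_reduced (concat (replicate k w))" if "\<not> thesis"
      by (rule twin_reduced_power[OF True]) (use \<open>\<not> thesis\<close> cyc iso True in blast)+
    then show thesis using power by blast
  next
    case False
    then show thesis using red by (elim not_twin_reducedE)
  qed
  then show ?case
  proof cases
    case red
    \<comment> \<open>Moving the second \<open>s\<close> across \<open>m\<close> makes the two
      cancel, which shortens \<open>w\<close> by two letters.\<close>
    have "twin_class n (s # m @ [s]) = twin_class n [s] \<otimes>\<^bsub>twin_group n\<^esub> twin_class n (m @ [s])"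
      using red w twin_class_append[of "[s]" n "m @ [s]"] by simp
    also have "\<dots> = twin_class n ([s, s] @ m)"
      using red w twin_class_append[of "[s]" n "s # m"] twin_class_shift[of m n s] by simp
    also have "\<dots> = twin_class n m"
      using red w twin_class_append[of "[s, s]" n m] twin_class_double[of s n] twin_class_carrier[of m n]
      by simp
    finally have eq: "twin_class n (s # m @ [s]) = twin_class n m" .
    have "twin_class n w = twin_class n p
        \<otimes>\<^bsub>twin_group n\<^esub> (twin_class n (s # m @ [s]) \<otimes>\<^bsub>twin_group n\<^esub> twin_class n q)"
      using red w twin_class_append[of p n "s # m @ s # q"] twin_class_append[of "s # m @ [s]" n q] by simp
    also have "\<dots> = twin_class n (p @ m @ q)"
      using red w twin_class_append[of p n "m @ q"] twin_class_append[of m n q] by (simp add: eq)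
    finally have "twin_class n w = twin_class n (p @ m @ q)" .
    then show ?thesis using less.hyps[of "p @ m @ q"] red less.prems by auto
  next
    case cyc
    let ?x = "twin_class n [x]" and ?v = "twin_class n (m @ r @ u)"
    have S: "x \<in> {1..n - 1}" "set m \<subseteq> {1..n - 1}" "set r \<subseteq> {1..n - 1}" "set u \<subseteq> {1..n - 1}"
      using w unfolding cyc(1) by simp_all
    have x: "?x \<in> carrier (twin_group n)" and v: "?v \<in> carrier (twin_group n)"
      by (rule twin_class_carrier, use S in simp)+
    have mx: "twin_class n (m @ [x]) = twin_class n (x # m)"
      using cyc(2) by (intro twin_class_shift S) simp
    have ux: "twin_class n (u @ [x]) = twin_class n (x # u)"
      using cyc(2) by (intro twin_class_shift S) simp
    \<comment> \<open>Since \<open>x\<close> commutes past \<open>m\<close> and \<open>u\<close>,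
      its two occurrences can be moved to the ends; as \<open>x\<close> is an involution,
      \<open>w\<close> is a conjugate of \<open>m @ r @ u\<close>.\<close>
    have "twin_class n w = twin_class n (m @ [x])
        \<otimes>\<^bsub>twin_group n\<^esub> (twin_class n r \<otimes>\<^bsub>twin_group n\<^esub> twin_class n (x # u))"
      using S by (simp add: cyc(1) twin_class_append[symmetric])
    also have "\<dots> = twin_class n (([x] @ m @ r @ u) @ [x])"
      unfolding mx ux[symmetric] using S by (simp add: twin_class_append[symmetric])
    also have "\<dots> = ?x \<otimes>\<^bsub>twin_group n\<^esub> ?v \<otimes>\<^bsub>twin_group n\<^esub> ?x"
      using S by (subst twin_class_append; simp add: twin_class_append[of "[x]" n "m @ r @ u", simplified])
    finally have "twin_class n w = ?x \<otimes>\<^bsub>twin_group n\<^esub> ?v \<otimes>\<^bsub>twin_group n\<^esub> ?x" .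
    moreover have xx: "?x \<otimes>\<^bsub>twin_group n\<^esub> ?x = \<one>\<^bsub>twin_group n\<^esub>"
      using S twin_class_append[of "[x]" n "[x]"] twin_class_double[of x n] by simp
    then have "inv\<^bsub>twin_group n\<^esub> ?x = ?x" using x by (simp add: inv_equality)
    ultimately have wv: "twin_class n w = ?x \<otimes>\<^bsub>twin_group n\<^esub> ?v \<otimes>\<^bsub>twin_group n\<^esub> inv\<^bsub>twin_group n\<^esub> ?x"
      by simp
    interpret conj: group_hom "twin_group n" "twin_group n"
      "\<lambda>y. ?x \<otimes>\<^bsub>twin_group n\<^esub> y \<otimes>\<^bsub>twin_group n\<^esub> inv\<^bsub>twin_group n\<^esub> ?x"
      using conj_hom[OF x] by unfold_locales
    \<comment> \<open>Both the torsion condition and purity are invariant under conjugation, so they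
      pass to the shorter word.\<close>
    have "?v [^]\<^bsub>twin_group n\<^esub> k = \<one>\<^bsub>twin_group n\<^esub>"
      using less.prems(4) x v conj.hom_nat_pow[OF v, of k] by (simp add: wv conj_eq_one_iff)
    moreover have "twin_perm n ?v = \<one>\<^bsub>sym_group n\<^esub>"
      using less.prems(2) x v perm.H.conj_eq_one_iff[of "twin_perm n ?x" "twin_perm n ?v"]
      by (simp add: wv)
    ultimately have "?v = \<one>\<^bsub>twin_group n\<^esub>"
      using S by (intro less.hyps less.prems(3)) (simp_all add: cyc(1))
    then show ?thesis using wv x by simp
  next
    case iso
    obtain p q where w': "w = p @ x # q" using iso by (meson split_list)
    \<comment> \<open>Two occurrences of the isolated letter could be moved together and cancelled,
      so in a reduced word it occurs only once.\<close>
    have "x \<notin> set q"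
      using front_if_isolated[of x q] twin_reduced_suffix[of p "x # q"] iso w' by auto
    moreover have False if "x \<in> set p"
    proof -
      obtain p' p'' where p: "p = p' @ x # p''" using \<open>x \<in> set p\<close> by (meson split_list)
      then show False
        using front_if_isolated[of x "p'' @ x # q"] twin_reduced_suffix[of p' "x # p'' @ x # q"] iso w'
        by auto
    qed
    ultimately have "x \<notin> set p \<union> set q" by auto
    then have "\<forall>y\<in>set p \<union> set q. far y x" using iso w' by auto
    then have "twin_perm n (twin_class n w) x = Suc x"
      using twin_perm_class[OF w] twin_perm_isolated[of p q x] w' by simp
    then show ?thesis using less.prems(2) by (simp add: sym_group_one)
  next
    case power
    have "set (concat (replicate k w)) \<subseteq> {1..n - 1}" using w by auto
    then have "concat (replicate k w) = []"
      using power less.prems(4) by (intro twin_class_reduced_eq_one) (auto simp: twin_class_replicate[OF w])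
    then have "w = []" using less.prems(3) by (cases k) auto
    then show ?thesis by (simp add: twin_class_Nil)
  qed
qed

lemma torsion_free_pure_twin_group: "torsion_free_group (pure_twin_group n)"
proof -
  interpret group "twin_group n" by (rule group_twin_group)
  show ?thesis
    unfolding torsion_free_group_def
  proof (intro ballI impI allI notI)
    fix g and k :: nat
    assume g: "g \<in> carrier (pure_twin_group n)" "g \<noteq> \<one>\<^bsub>pure_twin_group n\<^esub>" "0 < k"
      "g [^]\<^bsub>pure_twin_group n\<^esub> k = \<one>\<^bsub>pure_twin_group n\<^esub>"
    then have "g \<in> carrier (twin_group n)" "twin_perm n g = \<one>\<^bsub>sym_group n\<^esub>"
      by (auto simp: pure_twin_group_def kernel_def)
    moreover from this obtain w where "set w \<subseteq> {1..n - 1}" "g = twin_class n w"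
      by (elim twin_class_ex)
    ultimately have "g = \<one>\<^bsub>twin_group n\<^esub>"
      using twin_class_torsion[of w n k] g
      by (auto simp: pure_twin_group_def nat_pow_consistent[symmetric])
    then show False using g(2) by (simp add: pure_twin_group_def)
  qed
qed

section \<open>Commuting pure elements\<close>

text \<open>The product of two neighbouring transpositions is a 3-cycle, so its cube is trivial.
  Neighbouring letters do not commute, so the alternating word is reduced and its class is
  nontrivial.\<close>

lemma pure_twin_braid:
  assumes "1 \<le> i" "Suc i < n"
  shows "twin_class n [i, Suc i, i, Suc i, i, Suc i] \<in> carrier (pure_twin_group n)"
    "twin_class n [i, Suc i, i, Suc i, i, Suc i] \<noteq> \<one>\<^bsub>pure_twin_group n\<^esub>"
proof -
  let ?w = "[i, Suc i, i, Suc i, i, Suc i]"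
  have w: "set ?w \<subseteq> {1..n - 1}" using assms by auto
  have "foldr (\<lambda>i p. transpose i (i + 1) \<circ> p) ?w id x = x" for x
    by (cases "x = i"; cases "x = Suc i"; cases "x = Suc (Suc i)") (simp_all add: transpose_def)
  then have "twin_perm n (twin_class n ?w) = id"
    unfolding twin_perm_class[OF w] by (intro ext) simp
  then show "twin_class n ?w \<in> carrier (pure_twin_group n)"
    using twin_class_carrier[OF w] by (simp add: pure_twin_group_def kernel_def sym_group_one)
  have "twin_reduced ?w" by (simp add: far_def)
  then show "twin_class n ?w \<noteq> \<one>\<^bsub>pure_twin_group n\<^esub>"
    using twin_class_reduced_eq_one[OF w] by (auto simp: pure_twin_group_def)
qed

text \<open>Killing the generators outside \<open>P\<close> turns each defining relation into itself
  or a trivial identity.\<close>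

lemma twin_retraction:
  obtains r where "r \<in> hom (twin_group n) (twin_group n)"
    "\<And>w. set w \<subseteq> {1..n - 1} \<Longrightarrow> r (twin_class n w) = twin_class n (filter P w)"
proof -
  interpret group "twin_group n" by (rule group_twin_group)
  let ?f = "\<lambda>i. if P i then twin_class n [i] else \<one>\<^bsub>twin_group n\<^esub>"
  have f: "?f \<in> {1..n - 1} \<rightarrow> carrier (twin_group n)"
    by (auto intro!: twin_class_carrier)
  have ev: "word_eval (twin_group n) ?f (map (\<lambda>i. (i, True)) w) = twin_class n (filter P w)"
    if "set w \<subseteq> {1..n - 1}" for w
    using that
  proof (induction w)
    case (Cons x w)
    then have "set (filter P w) \<subseteq> {1..n - 1}" by auto
    then show ?case
      using Cons twin_class_append[of "[x]" n "filter P w"] twin_class_carrier[of "filter P w" n]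
      by (simp add: letter_eval_def)
  qed (simp add: twin_class_Nil)
  have R: "word_eval (twin_group n) ?f u = word_eval (twin_group n) ?f v"
    if "(u, v) \<in> twin_relations n" for u v
    using that unfolding twin_relations_def
  proof (elim UnE CollectE exE conjE)
    fix i assume "(u, v) = ([(i, True), (i, True)], [])" "i \<in> {1..n - 1}"
    then show ?thesis using ev[of "[i, i]"] ev[of "[]"] by (auto simp: twin_class_double twin_class_Nil)
  next
    fix i j assume "(u, v) = ([(i, True), (j, True)], [(j, True), (i, True)])"
      "i \<in> {1..n - 1}" "j \<in> {1..n - 1}" "2 \<le> \<bar>int i - int j\<bar>"
    then show ?thesis using ev[of "[i, j]"] ev[of "[j, i]"] twin_class_swap[of i n j]
      by (auto simp: far_iff_abs)
  qed
  show thesis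
  proof
    show "pres_lift (twin_group n) ?f \<in> hom (twin_group n) (twin_group n)"
      using pres_lift_hom[OF f R] by (simp add: twin_group_def)
    fix w assume w: "set w \<subseteq> {1..n - 1}"
    show "pres_lift (twin_group n) ?f (twin_class n w) = twin_class n (filter P w)"
      unfolding twin_class_def[of n w] using pres_lift_class[OF f R] ev[OF w] w by simp
  qed
qed

lemma not_free_pure_twin_group:
  assumes "n \<ge> 6"
  shows "\<not> is_free_group (pure_twin_group n)"
proof
  assume "is_free_group (pure_twin_group n)"
  then obtain X where iso: "pres_lift (pure_twin_group n) (\<lambda>x. x) \<in> iso (free_group X) (pure_twin_group n)"
    by (auto simp: is_free_group_def is_free_basis_def)
  let ?P = "pure_twin_group n" and ?F = "free_group X"
  define h where "h = pres_lift ?P (\<lambda>x. x)"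
  interpret T: group "twin_group n" by (rule group_twin_group)
  interpret h: group_hom ?F ?P h
    using iso group_free_group group_pure_twin_group
    by (auto simp: group_hom_def group_hom_axioms_def iso_def h_def)
  have bij: "bij_betw h (carrier ?F) (carrier ?P)" using iso by (simp add: iso_def h_def)
  \<comment> \<open>Omitting the index 3 makes all letters of \<open>?u\<close> far from those of
    \<open>?v\<close>; \<open>n \<ge> 6\<close> makes 5 an admissible index.\<close>
  let ?u = "[1, 2, 1, 2, 1, 2] :: nat list" and ?v = "[4, 5, 4, 5, 4, 5] :: nat list"
  have u: "set ?u \<subseteq> {1..n - 1}" and v: "set ?v \<subseteq> {1..n - 1}" using assms by auto
  have a: "twin_class n ?u \<in> carrier ?P" "twin_class n ?u \<noteq> \<one>\<^bsub>?P\<^esub>"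
    and b: "twin_class n ?v \<in> carrier ?P" "twin_class n ?v \<noteq> \<one>\<^bsub>?P\<^esub>"
    using pure_twin_braid[of 1 n] pure_twin_braid[of 4 n] assms by (simp_all add: numeral_eq_Suc)
  have img: "carrier ?P = h ` carrier ?F" using bij by (simp add: bij_betw_def)
  obtain A where A: "h A = twin_class n ?u" "A \<in> carrier ?F"
    using a(1) unfolding img by (elim imageE) simp
  obtain B where B: "h B = twin_class n ?v" "B \<in> carrier ?F"
    using b(1) unfolding img by (elim imageE) simp
  have comm: "twin_class n (?u @ w) = twin_class n (w @ ?u)"
    if "set w \<subseteq> {4, 5}" for w
    using that
  proof (induction w)
    case (Cons x w)
    have w: "set w \<subseteq> {1..n - 1}" "set [x] \<subseteq> {1..n - 1}" and x: "\<forall>y\<in>set ?u. far y x"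
      using Cons.prems assms by (auto simp: far_def)
    have "twin_class n (?u @ x # w) = twin_class n (?u @ [x]) \<otimes>\<^bsub>twin_group n\<^esub> twin_class n w"
      using u w by (subst twin_class_append[symmetric]) simp_all
    also have "\<dots> = twin_class n (x # ?u) \<otimes>\<^bsub>twin_group n\<^esub> twin_class n w"
      using u w x twin_class_shift[of ?u n x] by simp
    also have "\<dots> = twin_class n [x] \<otimes>\<^bsub>twin_group n\<^esub> twin_class n (?u @ w)"
      using u w by (subst (1 2) twin_class_append[symmetric]) simp_all
    also have "\<dots> = twin_class n [x] \<otimes>\<^bsub>twin_group n\<^esub> twin_class n (w @ ?u)"
      using Cons by simp
    also have "\<dots> = twin_class n ((x # w) @ ?u)"
      using u w by (subst twin_class_append[symmetric]) simp_all
    finally show ?case .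
  qed simp
  have "h (A \<otimes>\<^bsub>?F\<^esub> B) = h (B \<otimes>\<^bsub>?F\<^esub> A)"
    using A B comm[of ?v] u v twin_class_append[of ?u n ?v] twin_class_append[of ?v n ?u]
    by (simp add: pure_twin_group_def)
  \<comment> \<open>The isomorphism \<open>h\<close> is injective, so the commutation holds already
    in the free group.\<close>
  then have "A \<otimes>\<^bsub>?F\<^esub> B = B \<otimes>\<^bsub>?F\<^esub> A"
    using A(2) B(2) bij by (intro inj_onD[of h "carrier ?F"]) (simp_all add: bij_betw_def)
  moreover have "A \<noteq> \<one>\<^bsub>?F\<^esub>" "B \<noteq> \<one>\<^bsub>?F\<^esub>" using A B a b h.hom_one by metis+
  ultimately obtain k :: nat and l :: int where k: "k > 0" "A [^]\<^bsub>?F\<^esub> k = B [^]\<^bsub>?F\<^esub> l"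
    using free_group_commute_powers[of A X B] A B by blast
  \<comment> \<open>This retraction fixes the class of \<open>?u\<close> and sends that of
    \<open>?v\<close> to the identity, so the common power forces torsion on
    \<open>?u\<close>.\<close>
  obtain r where r: "r \<in> hom (twin_group n) (twin_group n)"
    "\<And>w. set w \<subseteq> {1..n - 1} \<Longrightarrow> r (twin_class n w) = twin_class n (filter (\<lambda>i. i \<le> 2) w)"
    using twin_retraction[of n "\<lambda>i. i \<le> 2"] by blast
  have "r \<circ> h \<in> hom ?F (twin_group n)"
    using r(1) h.homh by (auto simp: hom_def pure_twin_group_def kernel_def Pi_iff)
  then interpret rh: group_hom ?F "twin_group n" "r \<circ> h"
    by unfold_locales
  have "twin_class n ?u [^]\<^bsub>twin_group n\<^esub> k = \<one>\<^bsub>twin_group n\<^esub>"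
    using k A B u v r(2) rh.hom_nat_pow[of A k] rh.hom_int_pow[of B l] by (simp add: twin_class_Nil)
  then have "twin_class n ?u [^]\<^bsub>?P\<^esub> k = \<one>\<^bsub>?P\<^esub>"
    by (simp add: pure_twin_group_def T.nat_pow_consistent[symmetric])
  then show False using torsion_free_pure_twin_group[of n] a k(1) by (auto simp: torsion_free_group_def)
qed

theorem theorem3p2:
  shows "(\<forall>n::nat. n \<ge> 6 \<longrightarrow> \<not> is_free_group (pure_twin_group n)) \<and>
         (\<forall>n::nat. n \<ge> 3 \<longrightarrow> torsion_free_group (pure_twin_group n))"
  using not_free_pure_twin_group torsion_free_pure_twin_group by blast

end
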